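(* Let $\chi\in\mathcal C_n$ be a complete simple game with exactly one shift-minimal winning vector $\widetilde a$. Then $\mu(\chi)\le\sqrt n$.
   Context: Let $N=\{1,\dots,n\}$. A simple game on $n$ voters is a function $\chi:2^N\to\{0,1\}$ with $\chi(\emptyset)=0$, $\chi(N)=1$ and $\chi(S)\le\chi(T)$ whenever $S\subseteq T\subseteq N$. A coalition $S$ is winning if $\chi(S)=1$ and losing if $\chi(S)=0$. For voters $i,j\in N$ write $i\sqsupset j$ if $\chi(\{i\}\cup S\setminus\{j\})\ge\chi(S)$ for all $S$ with $j\in S\subseteq N\setminus\{i\}$. The simple game is complete if $\sqsupset$ is a total preorder on $N$; $\mathcal C_n$ is the set of complete simple games on $n$ voters. Voters $i,j$ are equivalent if $i\sqsupset j$ and $j\sqsupset i$; let $N_1,\dots,N_t$ be the equivalence classes, ordered by decreasing influence (for $u\le v$, $i\in N_u$, $j\in N_v$ we have $i\sqsupset j$), and $n_h=|N_h|$. A coalition $S$ is described by the vector $(a_1,\dots,a_t)$ with $a_h=|S\cap N_h|$, $0\le a_h\le n_h$; whether $S$ is winning depends only on this vector, so one speaks of winning and losing vectors. For integer vectors, $\widetilde a\preceq\widetilde b$ means $\sum_{i=1}^k a_i\le\sum_{i=1}^k b_i$ for all $1\le k\le t$, and $\widetilde a\prec\widetilde b$ means $\widetilde a\preceq\widetilde b$ and $\widetilde a\ne\widetilde b$. A winning vector $\widetilde m$ is shift-minimal winning if every vector $\widetilde m'\prec\widetilde m$ (representing a coalition) is losing. For real weights write $w(S)=\sum_{i\in S}w_i$.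 For real $\alpha\ge 1$, $\chi$ is $\alpha$-roughly weighted if there are $w_1,\dots,w_n\in\mathbb R$ with $w(S)\ge 1$ for all winning coalitions $S$ and $w(S)\le\alpha$ for all losing coalitions $S$. The critical threshold value $\mu(\chi)$ is the smallest $\alpha\ge 1$ such that $\chi$ is $\alpha$-roughly weighted. *)

theory Defs
  imports Complex_Main
begin

abbreviation voters :: "nat \<Rightarrow> nat set" where
  "voters n \<equiv> {1..n}"

text \<open>A game is a total function on \<^typ>\<open>nat set\<close>; only its values on subsets of
  \<^term>\<open>voters n\<close> are constrained, and only these are ever used below.\<close>

definition simple_game :: "nat \<Rightarrow> (nat set \<Rightarrow> nat) \<Rightarrow> bool" where
  "simple_game n \<chi> \<longleftrightarrow>
     (\<forall>S. S \<subseteq> voters n \<longrightarrow> \<chi> S \<in> {0, 1}) \<and>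
     \<chi> {} = 0 \<and> \<chi> (voters n) = 1 \<and>
     (\<forall>S T. S \<subseteq> T \<and> T \<subseteq> voters n \<longrightarrow> \<chi> S \<le> \<chi> T)"

definition winning :: "nat \<Rightarrow> (nat set \<Rightarrow> nat) \<Rightarrow> nat set \<Rightarrow> bool" where
  "winning n \<chi> S \<longleftrightarrow> S \<subseteq> voters n \<and> \<chi> S = 1"

definition losing :: "nat \<Rightarrow> (nat set \<Rightarrow> nat) \<Rightarrow> nat set \<Rightarrow> bool" where
  "losing n \<chi> S \<longleftrightarrow> S \<subseteq> voters n \<and> \<chi> S = 0"

text \<open>\<open>(i, j) \<in> influence n \<chi>\<close> means that \<open>i\<close> is at least as influential as \<open>j\<close>.
  For \<open>i = j\<close> the condition on coalitions is vacuous.\<close>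

definition influence :: "nat \<Rightarrow> (nat set \<Rightarrow> nat) \<Rightarrow> (nat \<times> nat) set" where
  "influence n \<chi> = {(i, j). i \<in> voters n \<and> j \<in> voters n \<and>
     (\<forall>S. j \<in> S \<and> S \<subseteq> voters n - {i} \<longrightarrow> \<chi> (({i} \<union> S) - {j}) \<ge> \<chi> S)}"

definition complete_simple_game :: "nat \<Rightarrow> (nat set \<Rightarrow> nat) \<Rightarrow> bool" where
  "complete_simple_game n \<chi> \<longleftrightarrow> simple_game n \<chi> \<and>
     preorder_on (voters n) (influence n \<chi>) \<and> total_on (voters n) (influence n \<chi>)"

definition voter_equiv :: "nat \<Rightarrow> (nat set \<Rightarrow> nat) \<Rightarrow> (nat \<times> nat) set" where
  "voter_equiv n \<chi> = {(i, j). (i, j) \<in> influence n \<chi> \<and> (j, i) \<in> influence n \<chi>}"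

text \<open>The class with index \<open>h\<close>, counted from 1, is \<open>Ns ! (h - 1)\<close>, and \<open>t = length Ns\<close>.\<close>

definition ordered_classes :: "nat \<Rightarrow> (nat set \<Rightarrow> nat) \<Rightarrow> nat set list \<Rightarrow> bool" where
  "ordered_classes n \<chi> Ns \<longleftrightarrow>
     distinct Ns \<and> set Ns = voters n // voter_equiv n \<chi> \<and>
     (\<forall>u v i j. u \<le> v \<and> v < length Ns \<and> i \<in> Ns ! u \<and> j \<in> Ns ! v
        \<longrightarrow> (i, j) \<in> influence n \<chi>)"

definition coalition_vector :: "nat set list \<Rightarrow> nat set \<Rightarrow> int list" where
  "coalition_vector Ns S = map (\<lambda>C. int (card (S \<inter> C))) Ns"

definition winning_vector ::
  "nat \<Rightarrow> (nat set \<Rightarrow> nat) \<Rightarrow> nat set list \<Rightarrow> int list \<Rightarrow> bool" where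
  "winning_vector n \<chi> Ns a \<longleftrightarrow> (\<exists>S. winning n \<chi> S \<and> coalition_vector Ns S = a)"

definition losing_vector ::
  "nat \<Rightarrow> (nat set \<Rightarrow> nat) \<Rightarrow> nat set list \<Rightarrow> int list \<Rightarrow> bool" where
  "losing_vector n \<chi> Ns a \<longleftrightarrow> (\<exists>S. losing n \<chi> S \<and> coalition_vector Ns S = a)"

definition vec_preceq :: "int list \<Rightarrow> int list \<Rightarrow> bool" where
  "vec_preceq a b \<longleftrightarrow> length a = length b \<and>
     (\<forall>k\<in>{1..length a}. sum_list (take k a) \<le> sum_list (take k b))"

definition vec_prec :: "int list \<Rightarrow> int list \<Rightarrow> bool" where
  "vec_prec a b \<longleftrightarrow> vec_preceq a b \<and> a \<noteq> b"

definition shift_minimal_winning ::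
  "nat \<Rightarrow> (nat set \<Rightarrow> nat) \<Rightarrow> nat set list \<Rightarrow> int list \<Rightarrow> bool" where
  "shift_minimal_winning n \<chi> Ns m \<longleftrightarrow> winning_vector n \<chi> Ns m \<and>
     (\<forall>m'. (\<exists>S. S \<subseteq> voters n \<and> coalition_vector Ns S = m') \<and> vec_prec m' m
        \<longrightarrow> losing_vector n \<chi> Ns m')"

definition roughly_weighted :: "nat \<Rightarrow> real \<Rightarrow> (nat set \<Rightarrow> nat) \<Rightarrow> bool" where
  "roughly_weighted n \<alpha> \<chi> \<longleftrightarrow> (\<exists>w :: nat \<Rightarrow> real.
     (\<forall>S. winning n \<chi> S \<longrightarrow> sum w S \<ge> 1) \<and>
     (\<forall>S. losing n \<chi> S \<longrightarrow> sum w S \<le> \<alpha>))"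

definition critical_threshold :: "nat \<Rightarrow> (nat set \<Rightarrow> nat) \<Rightarrow> real" where
  "critical_threshold n \<chi> = (LEAST \<alpha>. \<alpha> \<ge> 1 \<and> roughly_weighted n \<alpha> \<chi>)"

text \<open>The enumeration of the equivalence classes by decreasing influence exists and is
  unique, so a hypothesis \<^term>\<open>ordered_classes n \<chi> Ns\<close> only names it.\<close>

lemma ordered_classes_exists:
  assumes "complete_simple_game n \<chi>"
  shows "\<exists>Ns. ordered_classes n \<chi> Ns"
proof -
  let ?R = "influence n \<chi>" and ?E = "voter_equiv n \<chi>"
  have refl: "\<And>i. i \<in> voters n \<Longrightarrow> (i, i) \<in> ?R" and tr: "trans ?R" and sub: "?R \<subseteq> voters n \<times> voters n"
    using assms by (auto simp: complete_simple_game_def preorder_on_def refl_on_def)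
  have tot: "(i, j) \<in> ?R \<or> (j, i) \<in> ?R" if "i \<in> voters n" "j \<in> voters n" for i j
    using assms refl that by (cases "i = j") (auto simp: complete_simple_game_def total_on_def)
  define up where "up i = {j. (j, i) \<in> ?R}" for i
  have finup: "finite (up i)" for i
    by (rule finite_subset[of _ "voters n"]) (use sub in \<open>auto simp: up_def\<close>)
  define key where "key C = card (up (SOME i. i \<in> C))" for C
  have fin: "finite (voters n // ?E)"
    by (simp add: quotient_def)
  obtain xs where xs: "set xs = voters n // ?E" "distinct xs"
    using finite_distinct_list[OF fin] by blast
  define Ns where "Ns = sort_key key xs"
  have Ns: "set Ns = voters n // ?E" "distinct Ns" "sorted (map key Ns)"
    using xs by (simp_all add: Ns_def)
  have key: "i \<in> voters n \<and> key C = card (up i)" if C: "C \<in> voters n // ?E" and i: "i \<in> C" for C i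
  proof -
    obtain c where c: "C = ?E `` {c}" using C by (auto simp: quotient_def)
    define s where "s = (SOME i. i \<in> C)"
    have "s \<in> C" unfolding s_def using i by (rule someI)
    then have "(s, c) \<in> ?R" "(c, s) \<in> ?R" "(i, c) \<in> ?R" "(c, i) \<in> ?R"
      using i by (auto simp: c voter_equiv_def)
    then have "(s, i) \<in> ?R" "(i, s) \<in> ?R" by (meson transD tr)+
    then have "up s = up i" unfolding up_def by (auto intro: transD[OF tr])
    then show ?thesis using \<open>(i, s) \<in> ?R\<close> sub by (auto simp: key_def s_def)
  qed
  have "(i, j) \<in> ?R" if uv: "u \<le> v" "v < length Ns" "i \<in> Ns ! u" "j \<in> Ns ! v" for u v i j
  proof (rule ccontr)
    assume neg: "(i, j) \<notin> ?R"
    have mem: "Ns ! u \<in> voters n // ?E" "Ns ! v \<in> voters n // ?E"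
      using uv Ns(1) by (metis nth_mem order.strict_trans1)+
    have ij: "i \<in> voters n" "j \<in> voters n" "key (Ns ! u) = card (up i)" "key (Ns ! v) = card (up j)"
      using key[OF mem(1) uv(3)] key[OF mem(2) uv(4)] by auto
    then have ji: "(j, i) \<in> ?R" using tot neg by blast
    have "up j \<subseteq> up i" using ji by (auto simp: up_def intro: transD[OF tr])
    moreover have "i \<in> up i" "i \<notin> up j" using refl[OF ij(1)] neg by (auto simp: up_def)
    ultimately have "card (up j) < card (up i)" by (intro psubset_card_mono finup) auto
    moreover have "key (Ns ! u) \<le> key (Ns ! v)"
      using sorted_nth_mono[OF Ns(3) uv(1)] uv by simp
    ultimately show False using ij by simp
  qed
  then show ?thesis using Ns unfolding ordered_classes_def by blast
qed

lemma ordered_classes_unique: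
  assumes "complete_simple_game n \<chi>" "ordered_classes n \<chi> Ns" "ordered_classes n \<chi> Ms"
  shows "Ns = Ms"
proof -
  let ?R = "influence n \<chi>" and ?E = "voter_equiv n \<chi>"
  define Q where "Q = voters n // ?E"
  define le where "le C D \<longleftrightarrow> (\<forall>i\<in>C. \<forall>j\<in>D. (i, j) \<in> ?R)" for C D
  have refl: "\<And>i. i \<in> voters n \<Longrightarrow> (i, i) \<in> ?R" and tr: "trans ?R" and sub: "?R \<subseteq> voters n \<times> voters n"
    using assms(1) by (auto simp: complete_simple_game_def preorder_on_def refl_on_def)
  have eq: "equiv (voters n) ?E"
    by (rule equivI) (use refl tr sub in \<open>auto simp: voter_equiv_def refl_on_def sym_def trans_def\<close>)
  have anti: "C = D" if CD: "C \<in> Q" "D \<in> Q" "le C D" "le D C" for C D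
  proof -
    obtain i j where "i \<in> C" "j \<in> D"
      using CD(1,2) in_quotient_imp_non_empty[OF eq] unfolding Q_def by blast
    then show ?thesis
      using CD quotient_eqI[OF eq, of C D i j] by (auto simp: le_def Q_def voter_equiv_def)
  qed
  have below: "{D \<in> Q. le D (Xs ! u)} = (!) Xs ` {..u}"
    if X: "ordered_classes n \<chi> Xs" and u: "u < length Xs" for Xs u
  proof -
    have set: "set Xs = Q" and mono: "\<And>u v. u \<le> v \<Longrightarrow> v < length Xs \<Longrightarrow> le (Xs ! u) (Xs ! v)"
      using X by (auto simp: ordered_classes_def le_def Q_def)
    have "D \<in> (!) Xs ` {..u}" if D: "D \<in> Q" "le D (Xs ! u)" for D
    proof -
      obtain v where v: "v < length Xs" "D = Xs ! v" using D(1) set by (metis in_set_conv_nth)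
      show ?thesis
      proof (cases "v \<le> u")
        case True then show ?thesis using v by auto
      next
        case False
        then have "le (Xs ! u) D" using mono v by simp
        then have "D = Xs ! u" using anti D set u nth_mem by blast
        then show ?thesis by auto
      qed
    qed
    then show ?thesis using set mono u by (auto intro: nth_mem)
  qed
  have card_below: "card {D \<in> Q. le D (Xs ! u)} = Suc u"
    if X: "ordered_classes n \<chi> Xs" and u: "u < length Xs" for Xs u
  proof -
    have "inj_on ((!) Xs) {..u}"
      using X u by (auto simp: ordered_classes_def inj_on_def nth_eq_iff_index_eq)
    then show ?thesis by (simp add: below[OF X u] card_image)
  qed
  have set: "set Ns = Q" "set Ms = Q" "length Ns = length Ms"
    using assms(2,3) by (auto simp: ordered_classes_def Q_def dest!: distinct_card)
  have "Ns ! u = Ms ! u" if u: "u < length Ns" for u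
  proof -
    have "Ns ! u \<in> set Ms" using u set nth_mem by metis
    then obtain v where v: "v < length Ms" "Ms ! v = Ns ! u" by (auto simp: in_set_conv_nth)
    have "Suc u = Suc v"
      using card_below[OF assms(2) u] card_below[OF assms(3) v(1)] v(2) by simp
    then show ?thesis using v by simp
  qed
  then show ?thesis using set(3) by (intro nth_equalityI) auto
qed

end

theory Submission
  imports Defs
begin

text \<open>Let \<open>T\<close> be a coalition whose vector is the shift-minimal winning vector \<open>a\<close>. By uniqueness
  the vector of every winning coalition dominates \<open>a\<close>; in particular every winning coalition has
  at least \<open>card T\<close> members. If \<open>card T \<ge> sqrt n\<close>, the uniform weights \<open>1 / card T\<close> show
  \<open>\<mu>(\<chi>) \<le> n / card T \<le> sqrt n\<close>. Otherwise let \<open>D\<close> be the set of voters at least as influential as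
  every member of \<open>T\<close>, and give weight 1 to the members of \<open>D\<close> and 0 to all others. Dominance up
  to the first class met by \<open>T\<close> shows that every winning coalition meets \<open>D\<close>, while a coalition
  with \<open>card T\<close> members in \<open>D\<close> arises from \<open>T\<close> by exchanges with more influential voters, hence is
  winning; so a losing coalition has weight less than \<open>card T < sqrt n\<close>.\<close>

section \<open>The critical threshold is attained\<close>

text \<open>Bolzano-Weierstrass for finitely many coordinates: each new coordinate is handled by
  passing to a further subsequence along which it is monotone, hence convergent; the limits found
  earlier survive.\<close>

lemma bounded_subsequence_on_finite:
  fixes f :: "nat \<Rightarrow> 'a \<Rightarrow> real"
  assumes "finite I" and bounded: "\<And>k i. i \<in> I \<Longrightarrow> \<bar>f k i\<bar> \<le> B"
  shows "\<exists>r l. strict_mono (r :: nat \<Rightarrow> nat) \<and> (\<forall>i\<in>I. (\<lambda>k. f (r k) i) \<longlonglongrightarrow> l i)"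
  using assms
proof (induction I rule: finite_induct)
  case empty
  show ?case by (rule exI[of _ id]) (simp add: strict_mono_def)
next
  case (insert j I)
  then obtain r l where r: "strict_mono (r :: nat \<Rightarrow> nat)"
      and l: "\<forall>i\<in>I. (\<lambda>k. f (r k) i) \<longlonglongrightarrow> l i"
    by auto
  obtain s :: "nat \<Rightarrow> nat" where s: "strict_mono s" "monoseq (\<lambda>k. f (r (s k)) j)"
    using seq_monosub[of "\<lambda>k. f (r k) j"] by auto
  have "Bseq (\<lambda>k. f (r (s k)) j)"
    by (rule BseqI'[of _ B]) (simp add: insert.prems)
  then obtain y where y: "(\<lambda>k. f (r (s k)) j) \<longlonglongrightarrow> y"
    using s(2) Bseq_monoseq_convergent by (auto simp: convergent_def)
  have "(\<lambda>k. f (r (s k)) i) \<longlonglongrightarrow> l i" if "i \<in> I" for i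
    using LIMSEQ_subseq_LIMSEQ[OF bspec[OF l that] s(1)] by (simp add: o_def)
  then have "\<forall>i\<in>insert j I. (\<lambda>k. f ((r \<circ> s) k) i) \<longlonglongrightarrow> (l(j := y)) i"
    using y insert.hyps by auto
  then show ?case
    using strict_mono_o[OF r s(1)] by blast
qed

text \<open>Clipping every weight to \<open>[0, \<alpha>]\<close> spoils neither condition. This
  confines the weights to a compact box, from which limits can be extracted.\<close>

lemma roughly_weighted_bounded_weights:
  assumes game: "simple_game n \<chi>" and \<alpha>: "1 \<le> \<alpha>" and "roughly_weighted n \<alpha> \<chi>"
  obtains w :: "nat \<Rightarrow> real" where "\<And>i. 0 \<le> w i" "\<And>i. w i \<le> \<alpha>"
    "\<And>S. winning n \<chi> S \<Longrightarrow> 1 \<le> sum w S" "\<And>S. losing n \<chi> S \<Longrightarrow> sum w S \<le> \<alpha>"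
proof -
  obtain w :: "nat \<Rightarrow> real" where win: "\<And>S. winning n \<chi> S \<Longrightarrow> 1 \<le> sum w S"
      and lose: "\<And>S. losing n \<chi> S \<Longrightarrow> sum w S \<le> \<alpha>"
    using assms(3) unfolding roughly_weighted_def by auto
  define v where "v i = max 0 (min \<alpha> (w i))" for i
  show ?thesis
  proof
    show "0 \<le> v i" "v i \<le> \<alpha>" for i
      using \<alpha> by (auto simp: v_def)
    fix S
    show "1 \<le> sum v S" if S: "winning n \<chi> S"
    proof -
      have fin: "finite S"
        using S finite_subset[of S "voters n"] by (simp add: winning_def)
      show ?thesis
      proof (cases "\<exists>i\<in>S. \<alpha> \<le> w i")
        case True
        then obtain i where i: "i \<in> S" "\<alpha> \<le> w i" by blast
        \<comment> \<open>One voter clipped to \<open>\<alpha>\<close> already contributes at least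
          1; without such a voter clipping can only raise weights.\<close>
        have "v i \<le> sum v S"
          by (rule member_le_sum[OF i(1) _ fin]) (simp add: v_def)
        then show ?thesis using i(2) \<alpha> by (simp add: v_def)
      next
        case False
        then have "sum w S \<le> sum v S"
          by (intro sum_mono) (auto simp: v_def)
        then show ?thesis using win[OF S] by simp
      qed
    qed
    show "sum v S \<le> \<alpha>" if S: "losing n \<chi> S"
    proof -
      have fin: "finite S"
        using S finite_subset[of S "voters n"] by (simp add: losing_def)
      \<comment> \<open>Clipping raises negative weights, so the bound for \<open>S\<close> does not
        transfer directly. The subset \<open>P\<close> is losing by monotonicity and carries all of
        the clipped weight of \<open>S\<close>.\<close>
      define P where "P = {i \<in> S. 0 < w i}"
      have "P \<subseteq> S" "S \<subseteq> voters n" "\<chi> S = 0"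
        using S by (auto simp: P_def losing_def)
      then have "\<chi> P \<le> 0"
        using game unfolding simple_game_def by metis
      then have "losing n \<chi> P"
        using \<open>P \<subseteq> S\<close> \<open>S \<subseteq> voters n\<close> by (auto simp: losing_def)
      have "sum v S = sum v P"
        by (rule sum.mono_neutral_right) (auto simp: P_def v_def fin)
      also have "\<dots> \<le> sum w P"
        by (rule sum_mono) (auto simp: P_def v_def)
      also have "\<dots> \<le> \<alpha>" by (rule lose) fact
      finally show ?thesis .
    qed
  qed
qed

text \<open>\<open>LEAST\<close> on the reals is unspecified unless the minimum is attained; compactness of the
  normalised weights provides that.\<close>

lemma critical_threshold_le:
  assumes game: "simple_game n \<chi>" and \<alpha>: "1 \<le> \<alpha>" "roughly_weighted n \<alpha> \<chi>"
  shows "critical_threshold n \<chi> \<le> \<alpha>"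
proof -
  define A where "A = {\<beta>. 1 \<le> \<beta> \<and> roughly_weighted n \<beta> \<chi>}"
  define \<mu> where "\<mu> = Inf A"
  have "A \<noteq> {}" and bdd: "bdd_below A"
    using \<alpha> by (auto simp: A_def bdd_below_def)
  have lower: "\<mu> \<le> \<beta>" if "\<beta> \<in> A" for \<beta>
    unfolding \<mu>_def by (rule cInf_lower[OF that bdd])
  have "1 \<le> \<mu>"
    unfolding \<mu>_def by (rule cInf_greatest[OF \<open>A \<noteq> {}\<close>]) (simp add: A_def)
  \<comment> \<open>Admissible thresholds \<open>\<beta> k\<close> tend to the infimum; a limit of
    their weights will witness the infimum itself, since weak inequalities pass to the
    limit.\<close>
  have "\<exists>\<beta>\<in>A. \<beta> < \<mu> + 1 / Suc k" for k
    by (rule cInf_lessD[OF \<open>A \<noteq> {}\<close>, folded \<mu>_def]) simp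
  then obtain \<beta> where \<beta>: "\<And>k. \<beta> k \<in> A" "\<And>k. \<beta> k < \<mu> + 1 / Suc k"
    by metis
  have \<beta>_lim: "\<beta> \<longlonglongrightarrow> \<mu>"
  proof (rule tendsto_sandwich[where f = "\<lambda>_. \<mu>" and h = "\<lambda>k. \<mu> + 1 / Suc k"])
    show "(\<lambda>k. \<mu> + 1 / Suc k) \<longlonglongrightarrow> \<mu>"
      using tendsto_add[OF tendsto_const LIMSEQ_inverse_real_of_nat, of \<mu>]
      by (simp add: inverse_eq_divide)
  qed (use \<beta> lower in \<open>auto intro!: always_eventually less_imp_le\<close>)
  have "\<exists>w :: nat \<Rightarrow> real. (\<forall>i. 0 \<le> w i \<and> w i \<le> \<beta> k) \<and>
      (\<forall>S. winning n \<chi> S \<longrightarrow> 1 \<le> sum w S) \<and> (\<forall>S. losing n \<chi> S \<longrightarrow> sum w S \<le> \<beta> k)" for k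
    using roughly_weighted_bounded_weights[OF game, of "\<beta> k"] \<beta>(1)[of k]
    unfolding A_def by (metis mem_Collect_eq)
  then obtain w :: "nat \<Rightarrow> nat \<Rightarrow> real" where w: "\<And>k i. 0 \<le> w k i" "\<And>k i. w k i \<le> \<beta> k"
      and win: "\<And>k S. winning n \<chi> S \<Longrightarrow> 1 \<le> sum (w k) S"
      and lose: "\<And>k S. losing n \<chi> S \<Longrightarrow> sum (w k) S \<le> \<beta> k"
    by metis
  \<comment> \<open>The bound has to be uniform in \<open>k\<close> for a convergent subsequence to
    be extracted.\<close>
  have "\<bar>w k i\<bar> \<le> \<mu> + 1" for k i
  proof -
    have "1 / real (Suc k) \<le> 1" by simp
    then show ?thesis using w(1)[of k i] w(2)[of k i] \<beta>(2)[of k] by linarith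
  qed
  then obtain r l where r: "strict_mono (r :: nat \<Rightarrow> nat)"
      and l: "\<And>i. i \<in> voters n \<Longrightarrow> (\<lambda>k. w (r k) i) \<longlonglongrightarrow> l i"
    using bounded_subsequence_on_finite[of "voters n" w "\<mu> + 1"] by (meson finite_atLeastAtMost)
  have lim: "(\<lambda>k. sum (w (r k)) S) \<longlonglongrightarrow> sum l S" if "S \<subseteq> voters n" for S
    by (rule tendsto_sum) (use l that in auto)
  have r_lim: "(\<lambda>k. \<beta> (r k)) \<longlonglongrightarrow> \<mu>"
    using LIMSEQ_subseq_LIMSEQ[OF \<beta>_lim r] by (simp add: o_def)
  have "roughly_weighted n \<mu> \<chi>"
    unfolding roughly_weighted_def
  proof (intro exI conjI allI impI)
    fix S
    show "1 \<le> sum l S" if "winning n \<chi> S"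
      by (rule tendsto_lowerbound[OF lim]) (use that win in \<open>auto simp: winning_def\<close>)
    show "sum l S \<le> \<mu>" if "losing n \<chi> S"
      by (rule tendsto_le[OF _ r_lim lim]) (use that lose in \<open>auto simp: losing_def\<close>)
  qed
  then have "critical_threshold n \<chi> = \<mu>"
    unfolding critical_threshold_def using \<open>1 \<le> \<mu>\<close> lower
    by (intro Least_equality) (auto simp: A_def)
  then show ?thesis using lower \<alpha> by (simp add: A_def)
qed

section \<open>Shift-minimal winning vectors and exchanges\<close>

lemma vec_preceq_antisym:
  assumes "vec_preceq a b" "vec_preceq b a"
  shows "a = b"
proof (rule nth_equalityI)
  show len: "length a = length b" using assms by (simp add: vec_preceq_def)
  \<comment> \<open>\<open>vec_preceq\<close> compares only nonempty prefixes, so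
    \<open>k = 0\<close> is separate; entry \<open>i\<close> is the difference of the prefix sums of
    lengths \<open>Suc i\<close> and \<open>i\<close>.\<close>
  have eq: "sum_list (take k a) = sum_list (take k b)" if "k \<le> length a" for k
    using assms that by (cases "k = 0") (auto simp: vec_preceq_def intro: antisym)
  show "a ! i = b ! i" if "i < length a" for i
    using eq[of i] eq[of "Suc i"] that len by (simp add: take_Suc_conv_app_nth)
qed

lemma vec_preceq_trans: "vec_preceq a b \<Longrightarrow> vec_preceq b c \<Longrightarrow> vec_preceq a c"
  unfolding vec_preceq_def by (metis order_trans)

text \<open>There are finitely many coalition vectors, so the winning ones below that of
  \<open>S\<close> have a minimal element. If the shift-minimal vector is unique, it therefore lies
  below every winning vector.\<close>

lemma shift_minimal_winning_below:
  assumes game: "simple_game n \<chi>" and S: "winning n \<chi> S"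
  shows "\<exists>m. shift_minimal_winning n \<chi> Ns m \<and> vec_preceq m (coalition_vector Ns S)"
proof -
  let ?v = "coalition_vector Ns"
  define V where "V = {m. winning_vector n \<chi> Ns m \<and> vec_preceq m (?v S)}"
  have "V \<subseteq> ?v ` Pow (voters n)"
    by (auto simp: V_def winning_vector_def winning_def)
  then have "finite V" by (rule finite_subset) simp
  moreover have "?v S \<in> V"
    using S by (auto simp: V_def winning_vector_def vec_preceq_def)
  moreover have "asymp_on V vec_prec"
    by (auto intro!: asymp_onI simp: vec_prec_def dest: vec_preceq_antisym)
  moreover have "transp_on V vec_prec"
    by (rule transp_onI) (metis vec_prec_def vec_preceq_antisym vec_preceq_trans)
  ultimately obtain m where m: "m \<in> V" "\<And>x. x \<in> V \<Longrightarrow> x \<noteq> m \<Longrightarrow> \<not> vec_prec x m"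
    using Finite_Set.bex_min_element[of V vec_prec] by blast
  \<comment> \<open>Minimality within \<open>V\<close> suffices: by transitivity, whatever lies
    below \<open>m\<close> also lies below the vector of \<open>S\<close>.\<close>
  have "losing_vector n \<chi> Ns (?v R)" if R: "R \<subseteq> voters n" "vec_prec (?v R) m" for R
  proof -
    have "vec_preceq (?v R) (?v S)" "?v R \<noteq> m"
      using R(2) m(1) vec_preceq_trans by (auto simp: V_def vec_prec_def)
    then have "\<not> winning n \<chi> R"
      using m(2)[of "?v R"] R by (auto simp: V_def winning_vector_def)
    then have "losing n \<chi> R"
      using R(1) game by (auto simp: simple_game_def winning_def losing_def)
    then show ?thesis by (auto simp: losing_vector_def)
  qed
  then have "shift_minimal_winning n \<chi> Ns m"
    using m(1) by (auto simp: shift_minimal_winning_def V_def)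
  then show ?thesis using m(1) by (auto simp: V_def)
qed

text \<open>Swapping some \<open>t\<close> in \<open>T - S\<close> for some \<open>d\<close> in
  \<open>S - T\<close> keeps the coalition winning, and \<open>card (T - S)\<close> such swaps turn
  \<open>T\<close> into \<open>S\<close>.\<close>

lemma winning_exchange:
  assumes game: "simple_game n \<chi>" and "winning n \<chi> T" and "S \<subseteq> voters n" and "card S = card T"
    and "\<And>d t. d \<in> S - T \<Longrightarrow> t \<in> T - S \<Longrightarrow> (d, t) \<in> influence n \<chi>"
  shows "winning n \<chi> S"
  using assms(2-)
proof (induction "card (T - S)" arbitrary: T)
  case 0
  have fin: "finite S" "finite T"
    using 0 by (auto simp: winning_def intro: finite_subset)
  then have "T \<subseteq> S" using 0 by simp
  then have "T = S" using card_subset_eq[OF fin(1)] 0 by simp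
  then show ?case using 0 by simp
next
  case (Suc k)
  have fin: "finite S" "finite T"
    using Suc.prems by (auto simp: winning_def intro: finite_subset)
  obtain t where t: "t \<in> T - S"
    using Suc.hyps(2) by (metis card.empty equals0I nat.distinct(1))
  \<comment> \<open>Equal cardinalities supply \<open>d\<close>: \<open>S \<subseteq> T\<close>
    would force \<open>S = T\<close>, contrary to \<open>t\<close>.\<close>
  obtain d where d: "d \<in> S - T"
    using t Suc.prems(3) fin by (metis Diff_iff card_subset_eq subsetI)
  define T' where "T' = ({d} \<union> T) - {t}"
  have T: "T \<subseteq> voters n" "\<chi> T = 1" and dn: "d \<in> voters n"
    using Suc.prems d by (auto simp: winning_def)
  have "t \<in> T \<and> T \<subseteq> voters n - {d}" using T t d by auto
  then have "\<chi> T' \<ge> \<chi> T"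
    using Suc.prems(4)[OF d t] unfolding influence_def T'_def by blast
  moreover have "T' \<subseteq> voters n" using T dn by (auto simp: T'_def)
  ultimately have "winning n \<chi> T'"
    using T game unfolding simple_game_def winning_def
    by (metis insert_iff not_one_le_zero singletonD)
  moreover have "T' - S = (T - S) - {t}" using d by (auto simp: T'_def)
  then have "k = card (T' - S)" using Suc.hyps(2) t fin by simp
  moreover have "card S = card T'"
    using Suc.prems(3) t d fin by (simp add: T'_def card_Diff_singleton)
  \<comment> \<open>Both differences only shrink under the swap, so the influence hypothesis is
    inherited by \<open>T'\<close>.\<close>
  moreover have "(d', t') \<in> influence n \<chi>" if "d' \<in> S - T'" "t' \<in> T' - S" for d' t'
    using that t d by (intro Suc.prems(4)) (auto simp: T'_def)
  ultimately show ?case using Suc.hyps(1) Suc.prems(2) by blast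
qed

section \<open>Equivalence classes and prefix sums of coalition vectors\<close>

lemma voter_equiv_equiv:
  assumes "complete_simple_game n \<chi>"
  shows "equiv (voters n) (voter_equiv n \<chi>)"
  using assms
  by (intro equivI)
    (auto simp: complete_simple_game_def preorder_on_def voter_equiv_def refl_on_def sym_def
      intro!: transI intro: transD)

text \<open>The classes partition the voters. Comparing the longest prefixes of two vectors thus
  compares the sizes of the coalitions.\<close>

lemma sum_list_coalition_vector:
  assumes game: "complete_simple_game n \<chi>" and Ns: "ordered_classes n \<chi> Ns"
    and S: "S \<subseteq> voters n"
  shows "sum_list (coalition_vector Ns S) = int (card S)"
proof -
  have set: "set Ns = voters n // voter_equiv n \<chi>" and dist: "distinct Ns"
    using Ns by (auto simp: ordered_classes_def)
  have un: "\<Union> (set Ns) = voters n"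
    unfolding set by (rule Union_quotient[OF voter_equiv_equiv[OF game]])
  have "sum_list (coalition_vector Ns S) = int (\<Sum>C\<in>set Ns. card (S \<inter> C))"
    by (simp add: coalition_vector_def sum_list_distinct_conv_sum_set[OF dist])
  also have "(\<Sum>C\<in>set Ns. card (S \<inter> C)) = card (\<Union>C\<in>set Ns. S \<inter> C)"
  proof (rule card_UN_disjoint[symmetric])
    show "\<forall>C\<in>set Ns. finite (S \<inter> C)"
      using S finite_subset[of S "voters n"] by auto
    show "\<forall>C\<in>set Ns. \<forall>D\<in>set Ns. C \<noteq> D \<longrightarrow> (S \<inter> C) \<inter> (S \<inter> D) = {}"
      using quotient_disj[OF voter_equiv_equiv[OF game]] unfolding set by blast
  qed simp
  also have "(\<Union>C\<in>set Ns. S \<inter> C) = S" using un S by auto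
  finally show ?thesis .
qed

text \<open>Let \<open>k\<close> be the first class met by \<open>T\<close>. The prefix sum through
  \<open>k\<close> is positive for \<open>T\<close>, hence for \<open>S\<close>, so \<open>S\<close>
  meets a class that comes no later than any class met by \<open>T\<close>.\<close>

lemma preceq_meets_dominating_voters:
  assumes game: "complete_simple_game n \<chi>" and Ns: "ordered_classes n \<chi> Ns"
    and T: "T \<subseteq> voters n" "T \<noteq> {}"
    and le: "vec_preceq (coalition_vector Ns T) (coalition_vector Ns S)"
  shows "\<exists>d\<in>S. \<forall>t\<in>T. (d, t) \<in> influence n \<chi>"
proof -
  have "\<Union> (set Ns) = voters n"
    using Ns Union_quotient[OF voter_equiv_equiv[OF game]] by (simp add: ordered_classes_def)
  then have cls: "\<exists>k<length Ns. t \<in> Ns ! k" if "t \<in> T" for t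
    using that T(1) by (metis UnionE in_set_conv_nth subsetD)
  define k where "k = (LEAST k. k < length Ns \<and> T \<inter> Ns ! k \<noteq> {})"
  have "\<exists>k. k < length Ns \<and> T \<inter> Ns ! k \<noteq> {}" using cls T(2) by blast
  then have k: "k < length Ns" "T \<inter> Ns ! k \<noteq> {}"
    unfolding k_def by (metis (mono_tags, lifting) LeastI_ex)+
  have least: "k \<le> j" if "j < length Ns" "T \<inter> Ns ! j \<noteq> {}" for j
    unfolding k_def using that by (intro Least_le) auto
  have "finite T" using T(1) by (rule finite_subset) simp
  then have "0 < card (T \<inter> Ns ! k)" using k(2) by (simp add: card_gt_0_iff)
  \<comment> \<open>Classes are indexed from 0, so the prefix of length \<open>Suc k\<close> ends
    with class \<open>k\<close>; its other entries are nonnegative.\<close>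
  also have "int (card (T \<inter> Ns ! k)) \<le> sum_list (take (Suc k) (coalition_vector Ns T))"
    using k(1) by (simp add: coalition_vector_def take_Suc_conv_app_nth)
      (auto intro!: sum_list_nonneg dest!: in_set_takeD)
  also have "\<dots> \<le> sum_list (take (Suc k) (coalition_vector Ns S))"
    using le k(1) by (simp add: vec_preceq_def coalition_vector_def)
  finally have pos: "0 < sum_list (take (Suc k) (coalition_vector Ns S))" by simp
  have "\<exists>j\<le>k. S \<inter> Ns ! j \<noteq> {}"
  proof (rule ccontr)
    assume "\<not> ?thesis"
    then have "\<forall>x\<in>set (take (Suc k) (coalition_vector Ns S)). x = 0"
      using k(1) by (auto simp: coalition_vector_def in_set_conv_nth)
    then have "sum_list (take (Suc k) (coalition_vector Ns S)) \<le> 0"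
      by (intro sum_list_nonpos) (metis order_refl)
    then show False using pos by simp
  qed
  then obtain j d where d: "j \<le> k" "d \<in> S" "d \<in> Ns ! j" by blast
  have "(d, t) \<in> influence n \<chi>" if t: "t \<in> T" for t
  proof -
    obtain i where i: "i < length Ns" "t \<in> Ns ! i" using cls t by blast
    then have "k \<le> i" using t by (intro least) auto
    then have "j \<le> i" using d(1) by simp
    then show ?thesis using Ns i d(3) unfolding ordered_classes_def by blast
  qed
  then show ?thesis using d(2) by blast
qed

section \<open>Weights according to the size of the minimal coalition\<close>

theorem lemma13:
  fixes n :: nat and \<chi> :: "nat set \<Rightarrow> nat" and Ns :: "nat set list"
  assumes "complete_simple_game n \<chi>"
    and "ordered_classes n \<chi> Ns"
    and "\<exists>!a. shift_minimal_winning n \<chi> Ns a"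
  shows "critical_threshold n \<chi> \<le> sqrt (real n)"
proof -
  have game: "simple_game n \<chi>" using assms(1) by (simp add: complete_simple_game_def)
  then have "n \<noteq> 0" by (cases n) (auto simp: simple_game_def)
  obtain a where a: "shift_minimal_winning n \<chi> Ns a" using assms(3) by blast
  then obtain T where T: "winning n \<chi> T" "coalition_vector Ns T = a"
    by (auto simp: shift_minimal_winning_def winning_vector_def)
  \<comment> \<open>Some shift-minimal winning vector lies below that of \<open>S\<close>, and by
    uniqueness it is \<open>a\<close>.\<close>
  have below: "vec_preceq (coalition_vector Ns T) (coalition_vector Ns S)" if "winning n \<chi> S" for S
    using shift_minimal_winning_below[OF game that, of Ns] assms(3) a T(2) by blast
  have Tn: "T \<subseteq> voters n" "T \<noteq> {}" using T game by (auto simp: winning_def simple_game_def)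
  have fin: "finite S" if "S \<subseteq> voters n" for S using that by (rule finite_subset) simp
  have "0 < card T" using Tn fin by (simp add: card_gt_0_iff)
  have card_win: "card T \<le> card S" if S: "winning n \<chi> S" for S
  proof -
    let ?v = "coalition_vector Ns"
    \<comment> \<open>For empty \<open>Ns\<close> the full length 0 is outside the range tested by
      \<open>vec_preceq\<close>, but both sums are then 0.\<close>
    have "sum_list (take (length Ns) (?v T)) \<le> sum_list (take (length Ns) (?v S))"
      using below[OF S] unfolding vec_preceq_def
      by (cases "Ns = []") (force simp: coalition_vector_def Suc_le_eq simp del: take_all)+
    moreover have "take (length Ns) (?v R) = ?v R" for R by (simp add: coalition_vector_def)
    ultimately show ?thesis
      using S Tn sum_list_coalition_vector[OF assms(1,2)] by (simp add: winning_def)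
  qed
  have "roughly_weighted n (sqrt n) \<chi>"
  proof (cases "sqrt n \<le> card T")
    case True
    define w :: "nat \<Rightarrow> real" where "w i = 1 / card T" for i
    show ?thesis
      unfolding roughly_weighted_def
    proof (intro exI conjI allI impI)
      fix S
      show "1 \<le> sum w S" if "winning n \<chi> S"
        using card_win[OF that] \<open>0 < card T\<close> by (simp add: w_def field_simps)
      show "sum w S \<le> sqrt n" if "losing n \<chi> S"
      proof -
        have "card S \<le> n"
          using that card_mono[of "voters n" S] by (simp add: losing_def)
        then have "real (card S) \<le> sqrt n * sqrt n" by simp
        also have "\<dots> \<le> sqrt n * card T" by (rule mult_left_mono[OF True]) simp
        finally show ?thesis using \<open>0 < card T\<close> by (simp add: w_def field_simps)
      qed
    qed
  next
    case False
    define D where "D = {d \<in> voters n. \<forall>t\<in>T. (d, t) \<in> influence n \<chi>}"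
    define w :: "nat \<Rightarrow> real" where "w i = (if i \<in> D then 1 else 0)" for i
    have weight: "sum w S = card (S \<inter> D)" if "S \<subseteq> voters n" for S
      using sum.inter_restrict[OF fin[OF that], of "\<lambda>_. 1 :: real" D] by (simp add: w_def)
    show ?thesis
      unfolding roughly_weighted_def
    proof (intro exI conjI allI impI)
      fix S
      show "1 \<le> sum w S" if S: "winning n \<chi> S"
      proof -
        have Sn: "S \<subseteq> voters n" using S by (simp add: winning_def)
        obtain d where "d \<in> S" "\<forall>t\<in>T. (d, t) \<in> influence n \<chi>"
          using preceq_meets_dominating_voters[OF assms(1,2) Tn below[OF S]] by blast
        then have "d \<in> S \<inter> D" using subsetD[OF Sn] by (simp add: D_def)
        then have "S \<inter> D \<noteq> {}" by blast
        then have "0 < card (S \<inter> D)" using fin[OF Sn] by (simp add: card_gt_0_iff)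
        then show ?thesis by (simp add: weight[OF Sn])
      qed
      show "sum w S \<le> sqrt n" if S: "losing n \<chi> S"
      proof -
        have Sn: "S \<subseteq> voters n" using S by (simp add: losing_def)
        have "card (S \<inter> D) < card T"
        proof (rule ccontr)
          assume "\<not> ?thesis"
          then have "card T \<le> card (S \<inter> D)" by simp
          then obtain R where R: "R \<subseteq> S \<inter> D" "card R = card T"
            by (rule obtain_subset_with_card_n)
          \<comment> \<open>Since \<open>R\<close> lies in \<open>D\<close>, each exchange brings in
            a voter at least as influential as the one it replaces. Monotonicity then makes
            \<open>S\<close> winning, a contradiction.\<close>
          have "winning n \<chi> R"
          proof (rule winning_exchange[OF game T(1) _ R(2)])
            show "R \<subseteq> voters n" using R(1) Sn by blast
            show "(d, t) \<in> influence n \<chi>" if "d \<in> R - T" "t \<in> T - R" for d t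
              using that R(1) unfolding D_def by blast
          qed
          moreover have "\<chi> R \<le> \<chi> S"
            using game le_infE[OF R(1)] Sn unfolding simple_game_def by metis
          ultimately show False using S by (simp add: winning_def losing_def)
        qed
        then show ?thesis using False by (simp add: weight[OF Sn])
      qed
    qed
  qed
  \<comment> \<open>\<open>n \<noteq> 0\<close> gives \<open>1 \<le> sqrt n\<close>, so
    \<open>sqrt n\<close> is in the range over which the threshold is minimised.\<close>
  then show ?thesis
    using \<open>n \<noteq> 0\<close> by (intro critical_threshold_le[OF game]) auto
qed

end
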